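(* Let $q\in(0,1)$, let $\alpha\in\mathbb{D}$ and $\phi_\alpha(z)=\frac{z-\alpha}{1-\overline\alpha z}$. Then the $q$-Berezin range $\mathbf{Ber}_q(C_{\phi_\alpha})$ of the composition operator $C_{\phi_\alpha}$ on $A^2(\mathbb{D})$ is symmetric with respect to the real axis.
   Context: $\mathbb{D}$ is the open unit disk; $A^2(\mathbb{D})$ is the Bergman space of holomorphic $f$ on $\mathbb{D}$ with $\int_{\mathbb{D}}|f|^2dA<\infty$, $dA$ being area measure normalized so that $\mathbb{D}$ has area $1$. Its normalized reproducing kernel is $\hat k_\lambda(z)=\frac{1-|\lambda|^2}{(1-\overline\lambda z)^2}$, $\lambda,z\in\mathbb{D}$. The composition operator is $C_{\phi_\alpha} f=f\circ\phi_\alpha$. For a bounded operator $T$ on $A^2(\mathbb{D})$, $\mathbf{Ber}_q(T)=\{\langle T\hat k_\lambda,\hat k_\mu\rangle:\lambda,\mu\in\mathbb{D},\ \langle\hat k_\lambda,\hat k_\mu\rangle=q\}$. *)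

theory Defs
  imports "HOL-Complex_Analysis.Complex_Analysis"
begin

abbreviation unit_disk :: "complex set" where
  "unit_disk \<equiv> ball 0 1"

text \<open>
  Elements of the Bergman space are represented by total functions; only their values on the
  disk matter.
\<close>

definition bergman_space :: "(complex \<Rightarrow> complex) set" where
  "bergman_space =
     {f. f holomorphic_on unit_disk \<and> set_integrable lborel unit_disk (\<lambda>z. (norm (f z))\<^sup>2)}"

text \<open>The unit disk has Lebesgue measure \<open>pi\<close>, so dividing by \<open>pi\<close> gives it area 1.\<close>

definition bergman_inner :: "(complex \<Rightarrow> complex) \<Rightarrow> (complex \<Rightarrow> complex) \<Rightarrow> complex" where
  "bergman_inner f g = (LINT z:unit_disk|lborel. f z * cnj (g z)) / of_real pi"

definition normalized_kernel :: "complex \<Rightarrow> complex \<Rightarrow> complex" where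
  "normalized_kernel l z = of_real (1 - (norm l)\<^sup>2) / (1 - cnj l * z)\<^sup>2"

definition composition_operator ::
    "(complex \<Rightarrow> complex) \<Rightarrow> (complex \<Rightarrow> complex) \<Rightarrow> complex \<Rightarrow> complex" where
  "composition_operator \<phi> = (\<lambda>f\<in>bergman_space. f \<circ> \<phi>)"

definition q_berezin_range ::
    "complex \<Rightarrow> ((complex \<Rightarrow> complex) \<Rightarrow> complex \<Rightarrow> complex) \<Rightarrow> complex set" where
  "q_berezin_range q T =
     {bergman_inner (T (normalized_kernel l)) (normalized_kernel m) | l m.
        l \<in> unit_disk \<and> m \<in> unit_disk \<and>
        bergman_inner (normalized_kernel l) (normalized_kernel m) = q}"

definition disk_automorphism :: "complex \<Rightarrow> complex \<Rightarrow> complex" where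
  "disk_automorphism \<alpha> z = (z - \<alpha>) / (1 - cnj \<alpha> * z)"

end

theory Submission
  imports Defs
begin

text \<open>
  Let \<open>J z = u * cnj z\<close> be the reflection in the real line spanned by \<open>\<alpha>\<close>, so \<open>|u| = 1\<close> and
  \<open>J \<alpha> = \<alpha>\<close>. It preserves area measure, commutes with the automorphism \<open>\<phi>\<close> of the disk, and
  \<open>f \<mapsto> cnj \<circ> f \<circ> J\<close> is an antiunitary involution that sends the kernel at \<open>l\<close> to the kernel at
  \<open>J l\<close>. Passing from \<open>(l, m)\<close> to \<open>(J l, J m)\<close> thus keeps the real inner product \<open>q\<close> of the two
  kernels and conjugates the corresponding point of the Berezin range.
\<close>

text \<open>A Borel measure giving every box its volume is \<open>lborel\<close>. The preimage of a
  box under \<open>f\<close> is its image under \<open>inv f\<close>, which is again orthogonal and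
  so preserves volume.\<close>

lemma lborel_distr_orthogonal_transformation:
  fixes f :: "real^'n::{finite,wellorder} \<Rightarrow> real^'n::_"
  assumes f: "orthogonal_transformation f"
  shows "distr lborel borel f = lborel"
proof (rule lborel_eqI[symmetric])
  fix l u :: "real^'n::{finite,wellorder}"
  assume le: "\<And>b. b \<in> Basis \<Longrightarrow> l \<bullet> b \<le> u \<bullet> b"
  have inv: "orthogonal_transformation (inv f)" and bij: "bij f"
    using f by (simp_all add: orthogonal_transformation_inv orthogonal_transformation_bij)
  have vimage: "f -` box l u = inv f ` box l u"
    using bij by (simp add: bij_vimage_eq_inv_image)
  have meas: "f \<in> borel_measurable borel"
    using f by (intro borel_measurable_continuous_onI linear_continuous_on)
      (simp add: linear_conv_bounded_linear[symmetric] orthogonal_transformation_linear)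
  have "f -` box l u \<in> sets borel"
    using measurable_sets[OF meas, of "box l u"] by simp
  then have "emeasure (distr lborel borel f) (box l u) = emeasure lebesgue (inv f ` box l u)"
    using meas by (simp add: emeasure_distr vimage)
  \<comment> \<open>Boxes and their orthogonal images have finite measure, so invariance of the
    real-valued \<open>measure\<close> lifts to \<open>emeasure\<close>.\<close>
  also have "\<dots> = emeasure lebesgue (box l u)"
    using measurable_orthogonal_image[OF inv, of "box l u"] measure_orthogonal_image[OF inv, of "box l u"]
    by (simp add: emeasure_eq_measure2)
  also have "\<dots> = (\<Prod>b\<in>Basis. (u - l) \<bullet> b)"
    using le by (simp add: emeasure_lborel_box_eq)
  finally show "emeasure (distr lborel borel f) (box l u) = (\<Prod>b\<in>Basis. (u - l) \<bullet> b)" .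
qed simp

text \<open>The coordinate isometries between \<open>complex\<close> and \<open>real^2\<close> carry
  the invariance just shown over to area on the complex plane.\<close>

definition vec_of_complex :: "complex \<Rightarrow> real^2" where
  "vec_of_complex z = vector [Re z, Im z]"

definition complex_of_vec :: "real^2 \<Rightarrow> complex" where
  "complex_of_vec v = Complex (v $ 1) (v $ 2)"

lemma complex_of_vec_of_complex [simp]: "complex_of_vec (vec_of_complex z) = z"
  by (simp add: complex_of_vec_def vec_of_complex_def)

lemma linear_vec_of_complex: "linear vec_of_complex"
  by (rule linearI) (simp_all add: vec_of_complex_def vec_eq_iff forall_2)

lemma linear_complex_of_vec: "linear complex_of_vec"
  by (rule linearI) (simp_all add: complex_of_vec_def complex_eq_iff)

lemma norm_vec_of_complex [simp]: "norm (vec_of_complex z) = norm z"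
  by (simp add: vec_of_complex_def norm_vec_def L2_set_def sum_2 cmod_def)

lemma norm_complex_of_vec [simp]: "norm (complex_of_vec v) = norm v"
  by (simp add: complex_of_vec_def norm_vec_def L2_set_def sum_2 cmod_def)

lemma measurable_complex_of_vec [measurable]: "complex_of_vec \<in> borel_measurable borel"
  by (intro borel_measurable_continuous_onI linear_continuous_on)
    (simp add: linear_conv_bounded_linear[symmetric] linear_complex_of_vec)

lemma distr_complex_of_vec: "distr lborel borel complex_of_vec = lborel"
proof (rule lborel_eqI[symmetric])
  fix l u :: complex
  assume le: "\<And>b. b \<in> Basis \<Longrightarrow> l \<bullet> b \<le> u \<bullet> b"
  have vimage: "complex_of_vec -` box l u = box (vec_of_complex l) (vec_of_complex u)"
    by (auto simp: complex_of_vec_def vec_of_complex_def box_def Basis_complex_def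
        mem_box_cart forall_2 Basis_vec_def inner_axis)
  \<comment> \<open>Nonnegative side lengths select the product case of the box volume formula on
    both sides.\<close>
  have "Re l \<le> Re u" "Im l \<le> Im u"
    using le[of 1] le[of \<i>] by (simp_all add: Basis_complex_def)
  moreover have Basis2: "(Basis :: (real^2) set) = {axis 1 1, axis 2 1}"
    by (auto simp: Basis_vec_def UNIV_2)
  ultimately show "emeasure (distr lborel borel complex_of_vec) (box l u) = (\<Prod>b\<in>Basis. (u - l) \<bullet> b)"
    by (auto simp: emeasure_distr vimage emeasure_lborel_box_eq Basis_complex_def Basis2
        vec_of_complex_def inner_axis axis_eq_axis)
qed simp

lemma lborel_distr_complex_isometry:
  fixes f :: "complex \<Rightarrow> complex"
  assumes lin: "linear f" and norm: "\<And>z. norm (f z) = norm z"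
  shows "distr lborel borel f = lborel"
proof -
  define g where "g = vec_of_complex \<circ> f \<circ> complex_of_vec"
  have g: "orthogonal_transformation g"
    using lin linear_vec_of_complex linear_complex_of_vec
    by (auto simp: g_def orthogonal_transformation norm intro!: linear_compose)
  have [measurable]: "f \<in> borel_measurable borel" "g \<in> borel_measurable borel"
    using lin g by (auto intro!: borel_measurable_continuous_onI linear_continuous_on
        simp: linear_conv_bounded_linear[symmetric] orthogonal_transformation_linear)
  \<comment> \<open>The identity \<open>f \<circ> complex_of_vec = complex_of_vec \<circ> g\<close>
    trades \<open>f\<close> on the plane for the orthogonal map \<open>g\<close> on
    \<open>real^2\<close>.\<close>
  have "distr lborel borel f = distr (distr lborel borel complex_of_vec) borel f"
    by (simp add: distr_complex_of_vec)
  also have "\<dots> = distr (distr lborel borel g) borel complex_of_vec"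
    by (simp add: distr_distr) (simp add: g_def comp_def)
  also have "\<dots> = lborel"
    by (simp add: lborel_distr_orthogonal_transformation[OF g] distr_complex_of_vec)
  finally show ?thesis .
qed

text \<open>For \<open>norm u = 1\<close> this is the reflection in the real line spanned by a
  square root of \<open>u\<close>.\<close>

definition reflection :: "complex \<Rightarrow> complex \<Rightarrow> complex" where
  "reflection u z = u * cnj z"

lemma norm_reflection [simp]: "norm u = 1 \<Longrightarrow> norm (reflection u z) = norm z"
  by (simp add: reflection_def norm_mult)

lemma reflection_reflection [simp]: "norm u = 1 \<Longrightarrow> reflection u (reflection u z) = z"
  by (simp add: reflection_def complex_norm_square[symmetric] mult.assoc[symmetric])

lemma linear_reflection: "linear (reflection u)"
  by (rule linearI) (simp_all add: reflection_def algebra_simps)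

lemma measurable_reflection [measurable]: "reflection u \<in> borel_measurable borel"
  unfolding reflection_def by (intro borel_measurable_continuous_onI continuous_intros)

lemma bergman_inner_reflection:
  assumes [measurable]: "f \<in> borel_measurable borel" "g \<in> borel_measurable borel"
    and u: "norm u = 1"
  shows "bergman_inner (\<lambda>z. cnj (f (reflection u z))) (\<lambda>z. cnj (g (reflection u z)))
    = cnj (bergman_inner f g)"
proof -
  let ?h = "\<lambda>z. indicator unit_disk z *\<^sub>R (f z * cnj (g z))"
  have "cnj \<in> borel_measurable borel"
    by (intro borel_measurable_continuous_onI continuous_intros)
  then have [measurable]: "(\<lambda>z. cnj (g z)) \<in> borel_measurable borel"
    by (rule measurable_compose[rotated]) measurable
  have [measurable]: "?h \<in> borel_measurable borel"
    by (intro borel_measurable_scaleR borel_measurable_indicator borel_measurable_times) auto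
  have "(LINT z|lborel. ?h (reflection u z)) = (LINT z|distr lborel borel (reflection u). ?h z)"
    by (subst integral_distr) auto
  also have "\<dots> = (LINT z|lborel. ?h z)"
    using u by (simp add: lborel_distr_complex_isometry linear_reflection)
  finally have eq: "(LINT z|lborel. ?h (reflection u z)) = (LINT z|lborel. ?h z)" .
  \<comment> \<open>The reflection preserves the norm, so the indicator of the disk may be evaluated
    at the reflected point.\<close>
  have "(LINT z:unit_disk|lborel. cnj (f (reflection u z)) * g (reflection u z))
      = (LINT z|lborel. cnj (?h (reflection u z)))"
    unfolding set_lebesgue_integral_def using u
    by (intro Bochner_Integration.integral_cong) (auto simp: indicator_def)
  \<comment> \<open>This covers the non-integrable case too, where both integrals take the default
    value 0.\<close>
  also have "\<dots> = cnj (LINT z|lborel. ?h z)"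
    by (simp only: Bochner_Integration.integral_cnj eq)
  finally show ?thesis
    by (simp add: bergman_inner_def set_lebesgue_integral_def)
qed

lemma one_minus_cnj_mult_nonzero:
  fixes l z :: complex
  assumes "norm l < 1" "norm z \<le> 1"
  shows "1 - cnj l * z \<noteq> 0"
proof
  assume "1 - cnj l * z = 0"
  then have "norm (cnj l * z) = 1"
    by simp
  moreover have "norm (cnj l * z) \<le> norm l"
    using assms by (simp add: norm_mult mult_left_le)
  ultimately show False
    using assms by simp
qed

text \<open>The denominator has no zero on the closed disk, so the squared modulus is continuous on
  a compact set. Membership is what lets \<open>composition_operator\<close> unfold: outside
  \<open>bergman_space\<close> its value is \<open>undefined\<close>.\<close>

lemma normalized_kernel_in_bergman_space:
  assumes l: "l \<in> unit_disk"
  shows "normalized_kernel l \<in> bergman_space"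
proof -
  have nz: "1 - cnj l * z \<noteq> 0" if "z \<in> cball 0 1" for z
    using one_minus_cnj_mult_nonzero[of l z] l that by simp
  have "normalized_kernel l holomorphic_on unit_disk"
    unfolding normalized_kernel_def using nz by (intro holomorphic_intros) auto
  moreover have "continuous_on (cball 0 1) (\<lambda>z. (norm (normalized_kernel l z))\<^sup>2)"
    unfolding normalized_kernel_def using nz by (intro continuous_intros) auto
  then have "set_integrable lborel (cball 0 1) (\<lambda>z. (norm (normalized_kernel l z))\<^sup>2)"
    unfolding set_integrable_def by (intro borel_integrable_compact) auto
  then have "set_integrable lborel unit_disk (\<lambda>z. (norm (normalized_kernel l z))\<^sup>2)"
    by (rule set_integrable_subset) auto
  ultimately show ?thesis
    by (simp add: bergman_space_def)
qed

lemma measurable_normalized_kernel [measurable]: "normalized_kernel l \<in> borel_measurable borel"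
  unfolding normalized_kernel_def by measurable

lemma measurable_disk_automorphism [measurable]: "disk_automorphism \<alpha> \<in> borel_measurable borel"
  unfolding disk_automorphism_def by measurable

text \<open>The numerators agree by norm preservation, and \<open>cnj (reflection u l) * z\<close>
  is the conjugate of \<open>cnj l * reflection u z\<close>.\<close>

lemma normalized_kernel_reflection:
  assumes "norm u = 1"
  shows "normalized_kernel (reflection u l) z = cnj (normalized_kernel l (reflection u z))"
  using assms by (simp add: normalized_kernel_def) (simp add: reflection_def mult_ac)

lemma disk_automorphism_reflection:
  assumes "norm u = 1" "reflection u \<alpha> = \<alpha>"
  shows "disk_automorphism \<alpha> (reflection u z) = reflection u (disk_automorphism \<alpha> z)"
proof -
  have "reflection u z - \<alpha> = reflection u (z - \<alpha>)"
    using assms(2) by (simp add: reflection_def algebra_simps)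
  \<comment> \<open>By \<open>u * cnj \<alpha> = \<alpha>\<close>, the reflection turns the
    denominator of the automorphism into its conjugate.\<close>
  moreover have "cnj \<alpha> * reflection u z = \<alpha> * cnj z"
    using assms(2) by (simp add: reflection_def mult_ac)
  ultimately show ?thesis
    by (simp add: disk_automorphism_def reflection_def)
qed

lemma exists_reflection_fixing: "\<exists>u. norm u = 1 \<and> reflection u \<alpha> = \<alpha>"
proof (cases "\<alpha> = 0")
  case True
  then show ?thesis
    by (intro exI[of _ 1]) (simp add: reflection_def)
next
  case False
  then show ?thesis
    \<comment> \<open>The witness is the only solution of
      \<open>u * cnj \<alpha> = \<alpha>\<close>.\<close>
    by (intro exI[of _ "\<alpha> / cnj \<alpha>"]) (simp add: reflection_def norm_divide)
qed

lemma cnj_q_berezin_range_subset: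
  fixes q :: real
  shows "cnj ` q_berezin_range (of_real q) (composition_operator (disk_automorphism \<alpha>))
       \<subseteq> q_berezin_range (of_real q) (composition_operator (disk_automorphism \<alpha>))"
proof
  fix w
  assume "w \<in> cnj ` q_berezin_range (of_real q) (composition_operator (disk_automorphism \<alpha>))"
  then obtain l m where l: "l \<in> unit_disk" and m: "m \<in> unit_disk"
    and q: "bergman_inner (normalized_kernel l) (normalized_kernel m) = of_real q"
    and w: "w = cnj (bergman_inner (composition_operator (disk_automorphism \<alpha>) (normalized_kernel l))
      (normalized_kernel m))"
    by (auto simp: q_berezin_range_def)
  obtain u where u: "norm u = 1" "reflection u \<alpha> = \<alpha>"
    using exists_reflection_fixing by blast
  have lm: "reflection u l \<in> unit_disk" "reflection u m \<in> unit_disk"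
    using l m u by simp_all
  have kernel: "normalized_kernel (reflection u x) = (\<lambda>z. cnj (normalized_kernel x (reflection u z)))" for x
    using u by (simp add: fun_eq_iff normalized_kernel_reflection)
  \<comment> \<open>The reflected inner product is the conjugate of \<open>of_real q\<close>, which
    is real.\<close>
  have "bergman_inner (normalized_kernel (reflection u l)) (normalized_kernel (reflection u m)) = of_real q"
    unfolding kernel using u q by (simp add: bergman_inner_reflection)
  moreover have "composition_operator (disk_automorphism \<alpha>) (normalized_kernel x)
      = normalized_kernel x \<circ> disk_automorphism \<alpha>" if "x \<in> unit_disk" for x
    using that by (simp add: composition_operator_def normalized_kernel_in_bergman_space)
  \<comment> \<open>Moving the reflection past the automorphism gives the form that
    \<open>bergman_inner_reflection\<close> expects.\<close>
  moreover have "normalized_kernel (reflection u l) \<circ> disk_automorphism \<alpha>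
      = (\<lambda>z. cnj ((normalized_kernel l \<circ> disk_automorphism \<alpha>) (reflection u z)))"
    using u by (simp add: fun_eq_iff kernel disk_automorphism_reflection)
  ultimately have "bergman_inner (composition_operator (disk_automorphism \<alpha>)
      (normalized_kernel (reflection u l))) (normalized_kernel (reflection u m)) = w"
    using u l lm w bergman_inner_reflection[of "normalized_kernel l \<circ> disk_automorphism \<alpha>" "normalized_kernel m" u]
    by (simp add: kernel[of m])
  then show "w \<in> q_berezin_range (of_real q) (composition_operator (disk_automorphism \<alpha>))"
    unfolding q_berezin_range_def
    using lm \<open>bergman_inner (normalized_kernel (reflection u l)) (normalized_kernel (reflection u m)) = of_real q\<close>
    by blast
qed

theorem theorem3p9:
  fixes q :: real and \<alpha> :: complex
  assumes "0 < q" and "q < 1"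
    and "\<alpha> \<in> unit_disk"
  shows "cnj ` q_berezin_range (of_real q) (composition_operator (disk_automorphism \<alpha>))
       = q_berezin_range (of_real q) (composition_operator (disk_automorphism \<alpha>))"
proof (rule subset_antisym)
  show "cnj ` q_berezin_range (of_real q) (composition_operator (disk_automorphism \<alpha>))
      \<subseteq> q_berezin_range (of_real q) (composition_operator (disk_automorphism \<alpha>))"
    by (rule cnj_q_berezin_range_subset)
  \<comment> \<open>Since \<open>cnj\<close> is an involution, applying it to the inclusion yields
    the reverse one.\<close>
  from image_mono[OF this, of cnj]
  show "q_berezin_range (of_real q) (composition_operator (disk_automorphism \<alpha>))
      \<subseteq> cnj ` q_berezin_range (of_real q) (composition_operator (disk_automorphism \<alpha>))"
    by (simp add: image_image)
qed

end
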